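(* The class of graphs that have an inside-obstacle representation and the class of graphs that have an outside-obstacle representation are incomparable, i.e., neither class is contained in the other.
   Context: An obstacle is a topologically open, non-self-intersecting polygonal region in the plane (possibly unbounded). Given an obstacle $C$ and a finite set $P$ of points in general position in the complement of $C$, the visibility graph $G_C(P)$ has vertex set $P$ and an edge $pq$ exactly when $\overline{pq}\cap C=\emptyset$; its straight-line drawing is the visibility drawing. A single-obstacle representation of $G$ is a pair $(P,C)$ with $G\cong G_C(P)$; it is an outside-obstacle representation if $C$ lies in the unbounded component of the complement of the visibility drawing, and an inside-obstacle representation if $C$ lies in the complement of that unbounded component. *)

theory Defs
  imports "HOL-Analysis.Analysis"
begin

type_synonym pt = "real^2"

definition ray :: "pt \<Rightarrow> pt \<Rightarrow> pt set" where
  "ray a d = {a + t *\<^sub>R d | t. 0 \<le> t}"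

definition polygonal_set :: "pt set \<Rightarrow> bool" where
  "polygonal_set B \<longleftrightarrow>
     (\<exists>S R. finite S \<and> finite R \<and> (\<forall>(a, d) \<in> R. d \<noteq> 0) \<and>
        B = (\<Union>(a, b) \<in> S. closed_segment a b) \<union> (\<Union>(a, d) \<in> R. ray a d))"

text \<open>An obstacle: an open, connected, polygonal region whose boundary is
  non-self-intersecting, i.e. a simple closed polygon (homeomorphic to a circle)
  or a simple unbounded polygonal chain (homeomorphic to a line).\<close>
definition obstacle :: "pt set \<Rightarrow> bool" where
  "obstacle C \<longleftrightarrow> open C \<and> connected C \<and> C \<noteq> {} \<and>
     polygonal_set (frontier C) \<and>
     (frontier C homeomorphic (sphere (0::pt) 1) \<or> frontier C homeomorphic (UNIV :: real set))"

definition general_position :: "pt set \<Rightarrow> bool" where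
  "general_position P \<longleftrightarrow>
     (\<forall>p\<in>P. \<forall>q\<in>P. \<forall>r\<in>P. p \<noteq> q \<and> q \<noteq> r \<and> p \<noteq> r \<longrightarrow> \<not> collinear {p, q, r})"

definition visible :: "pt set \<Rightarrow> pt set \<Rightarrow> pt \<Rightarrow> pt \<Rightarrow> bool" where
  "visible C P p q \<longleftrightarrow> p \<in> P \<and> q \<in> P \<and> p \<noteq> q \<and> closed_segment p q \<inter> C = {}"

definition drawing :: "pt set \<Rightarrow> pt set \<Rightarrow> pt set" where
  "drawing C P = P \<union> \<Union>{closed_segment p q | p q. visible C P p q}"

definition single_obstacle_rep :: "'v set \<Rightarrow> ('v \<Rightarrow> 'v \<Rightarrow> bool) \<Rightarrow> pt set \<Rightarrow> pt set \<Rightarrow> bool" where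
  "single_obstacle_rep V E P C \<longleftrightarrow>
     obstacle C \<and> finite P \<and> general_position P \<and> P \<inter> C = {} \<and>
     (\<exists>f. bij_betw f V P \<and> (\<forall>u\<in>V. \<forall>v\<in>V. E u v \<longleftrightarrow> visible C P (f u) (f v)))"

definition has_outside_obstacle_rep :: "'v set \<Rightarrow> ('v \<Rightarrow> 'v \<Rightarrow> bool) \<Rightarrow> bool" where
  "has_outside_obstacle_rep V E \<longleftrightarrow>
     (\<exists>P C. single_obstacle_rep V E P C \<and> C \<subseteq> outside (drawing C P))"

definition has_inside_obstacle_rep :: "'v set \<Rightarrow> ('v \<Rightarrow> 'v \<Rightarrow> bool) \<Rightarrow> bool" where
  "has_inside_obstacle_rep V E \<longleftrightarrow>
     (\<exists>P C. single_obstacle_rep V E P C \<and> C \<inter> outside (drawing C P) = {})"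

end

theory Submission
  imports Defs
begin

text \<open>
  If the obstacle lies outside, then the common neighbours of two non-adjacent points \<open>b, d\<close> all lie on
  the same side of the line \<open>bd\<close>: otherwise two of them together with \<open>b, d\<close> form a drawn 4-cycle that
  encloses the segment \<open>bd\<close>. Take points \<open>z, a\<^sub>i, b\<^sub>i\<close> (\<open>i < 5\<close>) whose only non-edges are \<open>a\<^sub>ib\<^sub>i\<close> and
  \<open>zb\<^sub>i\<close>. Each line \<open>zb\<^sub>i\<close> has all \<open>a\<^sub>j\<close> with \<open>j \<noteq> i\<close> on one side, by the pigeonhole principle on the same
  side for three indices \<open>i\<close>. This is incompatible with each segment \<open>a\<^sub>ib\<^sub>i\<close> having all other
  \<open>a\<^sub>j, b\<^sub>j\<close> on one side. An inside representation places the \<open>a\<^sub>i, b\<^sub>i\<close> around a small triangle such that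
  the segments \<open>a\<^sub>ib\<^sub>i\<close> meet in its centroid, and \<open>z\<close> on the side facing the \<open>a\<^sub>i\<close>.
  Conversely, the drawing of a single vertex has no bounded complementary component.
\<close>

subsection \<open>Orientation of triples and triangles\<close>

text \<open>Twice the signed area of the triangle, positive exactly for counterclockwise
  order.\<close>

definition orient :: "pt \<Rightarrow> pt \<Rightarrow> pt \<Rightarrow> real" where
  "orient p q r = (q$1 - p$1) * (r$2 - p$2) - (q$2 - p$2) * (r$1 - p$1)"

lemma pt_eq_iff: "(x::pt) = y \<longleftrightarrow> x$1 = y$1 \<and> x$2 = y$2"
  by (simp add: vec_eq_iff forall_2)

lemma collinear_iff_orient: "collinear {p, q, r} \<longleftrightarrow> orient p q r = 0"
proof -
  have *: "\<exists>c. y = c *\<^sub>R x" if "x \<noteq> 0" "x$1 * y$2 = x$2 * y$1" for x y :: pt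
  proof (cases "x$1 = 0")
    case True
    with that have "x$2 \<noteq> 0" by (simp add: pt_eq_iff)
    with that True have "y = (y$2 / x$2) *\<^sub>R x" by (simp add: pt_eq_iff)
    then show ?thesis ..
  next
    case False
    with that have "y = (y$1 / x$1) *\<^sub>R x" by (simp add: pt_eq_iff field_simps)
    then show ?thesis ..
  qed
  have "collinear {0, x, y} \<longleftrightarrow> x$1 * y$2 = x$2 * y$1" for x y :: pt
    using *[of x y] by (auto simp: collinear_lemma)
  then show ?thesis
    by (simp add: collinear_3 orient_def) (auto simp: algebra_simps)
qed

lemma orient_sum: "orient b c x + orient c a x + orient a b x = orient a b c"
  by (simp add: orient_def algebra_simps)

text \<open>Divided by \<open>orient a b c\<close>, the three orientations are the barycentric
  coordinates of \<open>x\<close>.\<close>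

lemma mem_triangle:
  assumes D: "orient a b c > 0"
    and "orient b c x \<ge> 0" "orient c a x \<ge> 0" "orient a b x \<ge> 0"
  shows "x \<in> convex hull {a, b, c}"
proof -
  let ?D = "orient a b c"
  let ?u = "orient b c x / ?D" and ?v = "orient c a x / ?D" and ?w = "orient a b x / ?D"
  have "?u + ?v + ?w = 1"
    using D orient_sum[of b c x a] by (simp flip: add_divide_distrib)
  moreover have "?D *\<^sub>R x = orient b c x *\<^sub>R a + orient c a x *\<^sub>R b + orient a b x *\<^sub>R c"
    by (simp add: pt_eq_iff orient_def algebra_simps)
  then have "x = (1 / ?D) *\<^sub>R (orient b c x *\<^sub>R a + orient c a x *\<^sub>R b + orient a b x *\<^sub>R c)"
    using D by (metis divide_self_if less_irrefl scaleR_one scaleR_scaleR times_divide_eq_left mult_1)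
  then have "x = ?u *\<^sub>R a + ?v *\<^sub>R b + ?w *\<^sub>R c"
    by (simp add: scaleR_add_right)
  moreover have "?u \<ge> 0" "?v \<ge> 0" "?w \<ge> 0"
    using assms by simp_all
  ultimately show ?thesis
    unfolding convex_hull_3 by blast
qed

lemma frontier_triangle:
  fixes a :: pt
  shows "frontier (convex hull {a,b,c}) = closed_segment a b \<union> closed_segment b c \<union> closed_segment c a"
  by (rule frontier_of_triangle) simp

subsection \<open>Common neighbours in outside representations\<close>

text \<open>A complementary component of \<open>D\<close> that meets \<open>R\<close> cannot cross
  \<open>frontier R\<close>, so it stays within the bounded set \<open>R\<close>.\<close>

lemma disjoint_outside_if_frontier_subset:
  fixes R :: "'a::real_normed_vector set"
  assumes "bounded R" "frontier R \<subseteq> D"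
  shows "R \<inter> outside D = {}"
proof -
  have False if "x \<in> R" "x \<in> outside D" for x
  proof -
    let ?K = "connected_component_set (- D) x"
    have x: "x \<notin> D" and unb: "\<not> bounded ?K"
      using that by (auto simp: outside_def)
    then have "x \<in> ?K \<inter> R"
      using \<open>x \<in> R\<close> by simp
    moreover have "?K \<inter> frontier R = {}"
      using assms(2) connected_component_subset[of "- D" x] by blast
    ultimately have "?K \<subseteq> R"
      using connected_Int_frontier[OF connected_connected_component[of "- D" x], of R] by blast
    then show False
      using unb assms(1) bounded_subset by blast
  qed
  then show ?thesis by blast
qed

lemma closed_segment_subset_drawing: "visible C P p q \<Longrightarrow> closed_segment p q \<subseteq> drawing C P"
  by (auto simp: drawing_def)

lemma orient_swap: "orient q p r = - orient p q r"
  by (simp add: orient_def algebra_simps)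

lemma orient_affine: "orient p q ((1 - t) *\<^sub>R x + t *\<^sub>R y) = (1 - t) * orient p q x + t * orient p q y"
  by (simp add: orient_def algebra_simps)

lemma continuous_on_orient [continuous_intros]:
  "continuous_on S f \<Longrightarrow> continuous_on S (\<lambda>x. orient p q (f x))"
  unfolding orient_def by (intro continuous_intros)

text \<open>The open segment from \<open>b\<close> to \<open>d\<close> is interior to the union of the triangles \<open>abd\<close> and \<open>bcd\<close>,
  whose frontier is therefore drawn.\<close>
lemma opposite_common_neighbours_visible:
  assumes C: "C \<subseteq> outside (drawing C P)" and bd: "b \<in> P" "d \<in> P" "b \<noteq> d"
    and vis: "visible C P a b" "visible C P a d" "visible C P c b" "visible C P c d"
    and a: "orient b d a > 0" and c: "orient b d c < 0"
  shows "visible C P b d"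
proof -
  let ?D = "drawing C P"
  let ?A = "convex hull {b, d, a}" and ?B = "convex hull {d, b, c}"
  \<comment> \<open>Intersection of the open half-planes along the four sides of the quadrilateral
    \<open>abcd\<close>; it contains the open diagonal \<open>bd\<close> even if the quadrilateral
    is not convex.\<close>
  define U where "U = {x. orient d a x > 0 \<and> orient a b x > 0 \<and> orient b c x > 0 \<and> orient c d x > 0}"
  have "open U"
    unfolding U_def by (intro open_Collect_conj open_Collect_less continuous_intros)
  moreover have "U \<subseteq> ?A \<union> ?B"
  proof
    fix x assume "x \<in> U"
    then show "x \<in> ?A \<union> ?B"
      using a c mem_triangle[of b d a x] mem_triangle[of d b c x]
      by (cases "orient b d x \<ge> 0") (auto simp: U_def orient_swap[of d b])
  qed
  ultimately have U: "U \<subseteq> interior (?A \<union> ?B)"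
    by (simp add: interior_maximal)
  have seg: "open_segment b d \<subseteq> U"
  proof
    fix x assume "x \<in> open_segment b d"
    then obtain t where t: "0 < t" "t < 1" and x: "x = (1 - t) *\<^sub>R b + t *\<^sub>R d"
      by (auto simp: in_segment)
    have "orient d a b > 0" "orient a b d > 0" "orient b c d > 0" "orient c d b > 0"
      using a c by (simp_all add: orient_def algebra_simps)
    moreover have "orient d a d = 0" "orient a b b = 0" "orient b c b = 0" "orient c d d = 0"
      by (simp_all add: orient_def)
    ultimately show "x \<in> U"
      using t by (simp add: U_def x orient_affine)
  qed
  have "frontier (?A \<union> ?B) \<subseteq> frontier ?A \<union> frontier ?B"
    by (rule frontier_Un_subset)
  moreover have "frontier (?A \<union> ?B) \<inter> open_segment b d = {}"
    using U seg by (auto simp: frontier_def)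
  ultimately have "frontier (?A \<union> ?B) \<subseteq> {b, d} \<union> closed_segment a b \<union> closed_segment a d
      \<union> closed_segment c b \<union> closed_segment c d"
    unfolding frontier_triangle
    by (auto simp: closed_segment_eq_open closed_segment_commute open_segment_commute)
  also have "\<dots> \<subseteq> ?D"
    using bd vis[THEN closed_segment_subset_drawing] by (auto simp: drawing_def)
  finally have "(?A \<union> ?B) \<inter> outside ?D = {}"
    by (intro disjoint_outside_if_frontier_subset) (auto intro: bounded_convex_hull)
  moreover have "closed_segment b d \<subseteq> ?A"
    by (simp add: segment_convex_hull hull_mono)
  ultimately show ?thesis
    using C bd by (auto simp: visible_def)
qed

lemma common_neighbours_same_side:
  assumes C: "C \<subseteq> outside (drawing C P)" and P: "general_position P"
    and bd: "b \<in> P" "d \<in> P" "b \<noteq> d" "\<not> visible C P b d"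
    and a: "visible C P a b" "visible C P a d" and c: "visible C P c b" "visible C P c d"
  shows "0 < orient b d a \<longleftrightarrow> 0 < orient b d c"
proof -
  have "orient b d x \<noteq> 0" if "visible C P x b" "visible C P x d" for x
    using that P bd unfolding general_position_def visible_def
    by (metis collinear_iff_orient)
  then show ?thesis
    using opposite_common_neighbours_visible[OF C bd(1-3)] a c bd(4) by (metis linorder_neqE_linordered_idom)
qed

subsection \<open>An unrealizable configuration\<close>

text \<open>The factor \<open>s\<close> is \<open>1\<close> or \<open>-1\<close> below, so that mirror images are covered by the same lemmas.\<close>
definition turn :: "real \<Rightarrow> pt \<Rightarrow> pt \<Rightarrow> pt \<Rightarrow> bool" where
  "turn s p q r \<longleftrightarrow> 0 < s * orient p q r"

lemma turn_rotate: "turn s p q r \<longleftrightarrow> turn s q r p"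
  by (simp add: turn_def orient_def algebra_simps)

lemma turn_swap:
  assumes "general_position P" "p \<in> P" "q \<in> P" "r \<in> P" "p \<noteq> q" "q \<noteq> r" "p \<noteq> r" "s \<noteq> 0"
  shows "turn s q p r \<longleftrightarrow> \<not> turn s p q r"
proof -
  have "orient p q r \<noteq> 0"
    using assms unfolding general_position_def collinear_iff_orient by blast
  then have "s * orient p q r \<noteq> 0"
    using assms by simp
  then show ?thesis
    unfolding turn_def orient_swap[of q] by linarith
qed

lemma orient_grassmann_pluecker:
  "orient t s q * orient t p r = orient t s p * orient t q r + orient t s r * orient t p q"
  by (simp add: orient_def algebra_simps)

text \<open>Angular order around \<open>t\<close> can be cyclic in general, but it is transitive on
  a half-plane bounded by the line \<open>tu\<close>.\<close>

lemma turn_trans: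
  assumes "turn s t u p" "turn s t u q" "turn s t u r" "turn s t p q" "turn s t q r"
  shows "turn s t p r"
proof -
  have "(s * orient t u q) * (s * orient t p r)
      = (s * orient t u p) * (s * orient t q r) + (s * orient t u r) * (s * orient t p q)"
    using orient_grassmann_pluecker[of t u q p r] by algebra
  also have "\<dots> > 0"
    using assms by (simp add: turn_def add_pos_pos)
  finally show ?thesis
    using assms(2) unfolding turn_def by (rule zero_less_mult_pos)
qed

text \<open>The same for the other half-plane of the line \<open>tu\<close>.\<close>

lemma turn_trans':
  assumes "turn s t p u" "turn s t q u" "turn s t r u" "turn s t p q" "turn s t q r"
  shows "turn s t p r"
proof -
  have "(s * orient t q u) * (s * orient t p r)
      = (s * orient t p u) * (s * orient t q r) + (s * orient t r u) * (s * orient t p q)"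
    unfolding orient_def by algebra
  also have "\<dots> > 0"
    using assms by (simp add: turn_def add_pos_pos)
  finally show ?thesis
    using assms(2) unfolding turn_def by (rule zero_less_mult_pos)
qed

text \<open>The contradiction is propositional: the thirteen instances of \<open>turn_trans\<close> were found with
  a SAT solver as a minimal unsatisfiable set, and \<open>canon\<close> expresses all orientations by those of increasing triples.\<close>
lemma no_sorted_triple:
  assumes P: "general_position P" and X: "{z, a1, a2, a3, b1, b2, b3} \<subseteq> P"
    and distinct: "distinct [z, a1, a2, a3, b1, b2, b3]" and s: "s \<noteq> 0"
    and sorted: "turn s z b1 b2" "turn s z b2 b3" "turn s z b1 b3"
    and left: "turn s z b1 a2" "turn s z b1 a3" "turn s z b2 a1" "turn s z b2 a3"
      "turn s z b3 a1" "turn s z b3 a2"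
    and pair1: "\<And>x y. x \<in> {a2, b2, a3, b3} \<Longrightarrow> y \<in> {a2, b2, a3, b3} \<Longrightarrow> turn s a1 b1 x \<longleftrightarrow> turn s a1 b1 y"
    and pair2: "\<And>x y. x \<in> {a1, b1, a3, b3} \<Longrightarrow> y \<in> {a1, b1, a3, b3} \<Longrightarrow> turn s a2 b2 x \<longleftrightarrow> turn s a2 b2 y"
    and pair3: "\<And>x y. x \<in> {a1, b1, a2, b2} \<Longrightarrow> y \<in> {a1, b1, a2, b2} \<Longrightarrow> turn s a3 b3 x \<longleftrightarrow> turn s a3 b3 y"
  shows False
proof -
  \<comment> \<open>Each side condition becomes equivalences with one fixed representative, a
    propositional form suited to \<open>sat\<close>.\<close>
  have sides: "turn s a1 b1 a2 \<longleftrightarrow> turn s a1 b1 b3" "turn s a1 b1 a3 \<longleftrightarrow> turn s a1 b1 b3"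
    "turn s a1 b1 b2 \<longleftrightarrow> turn s a1 b1 b3"
    "turn s a2 b2 a1 \<longleftrightarrow> turn s a2 b2 b3" "turn s a2 b2 b1 \<longleftrightarrow> turn s a2 b2 b3"
    "turn s a2 b2 a3 \<longleftrightarrow> turn s a2 b2 b3"
    "turn s a3 b3 a1 \<longleftrightarrow> turn s a3 b3 b2" "turn s a3 b3 b1 \<longleftrightarrow> turn s a3 b3 b2"
    "turn s a3 b3 a2 \<longleftrightarrow> turn s a3 b3 b2"
    using pair1 pair2 pair3 by blast+
  have canon: "turn s q p r = (\<not> turn s p q r)" "turn s q r p = turn s p q r"
    "turn s r p q = turn s p q r" "turn s p r q = (\<not> turn s p q r)" "turn s r q p = (\<not> turn s p q r)"
    if "p \<in> P" "q \<in> P" "r \<in> P" "p \<noteq> q" "q \<noteq> r" "p \<noteq> r" for p q r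
    using turn_swap[OF P that s] turn_rotate by metis+
  have mem: "z \<in> P" "a1 \<in> P" "a2 \<in> P" "a3 \<in> P" "b1 \<in> P" "b2 \<in> P" "b3 \<in> P"
    using X by simp_all
  have neq: "z \<noteq> a1" "z \<noteq> a2" "z \<noteq> a3" "z \<noteq> b1" "z \<noteq> b2" "z \<noteq> b3" "a1 \<noteq> a2" "a1 \<noteq> a3"
    "a1 \<noteq> b1" "a1 \<noteq> b2" "a1 \<noteq> b3" "a2 \<noteq> a3" "a2 \<noteq> b1" "a2 \<noteq> b2" "a2 \<noteq> b3" "a3 \<noteq> b1" "a3 \<noteq> b2"
    "a3 \<noteq> b3" "b1 \<noteq> b2" "b1 \<noteq> b3" "b2 \<noteq> b3"
    using distinct by auto
  note canons =
    canon[of z a1 a2] canon[of z a1 a3] canon[of z a1 b1] canon[of z a1 b2] canon[of z a1 b3]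
    canon[of z a2 a3] canon[of z a2 b1] canon[of z a2 b2] canon[of z a2 b3] canon[of z a3 b1]
    canon[of z a3 b2] canon[of z a3 b3] canon[of z b1 b2] canon[of z b1 b3] canon[of z b2 b3]
    canon[of a1 a2 a3] canon[of a1 a2 b1] canon[of a1 a2 b2] canon[of a1 a2 b3] canon[of a1 a3 b1]
    canon[of a1 a3 b2] canon[of a1 a3 b3] canon[of a1 b1 b2] canon[of a1 b1 b3] canon[of a1 b2 b3]
    canon[of a2 a3 b1] canon[of a2 a3 b2] canon[of a2 a3 b3] canon[of a2 b1 b2] canon[of a2 b1 b3]
    canon[of a2 b2 b3] canon[of a3 b1 b2] canon[of a3 b1 b3] canon[of a3 b2 b3] canon[of b1 b2 b3]
  note T = turn_trans[where s = s]
  note instances = T[of b3 a2 z b2 a3] T[of b3 a3 z b1 a1] T[of b3 a1 z b1 a3] T[of b3 a3 z b2 a2]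
    T[of b2 a1 z b1 a2] T[of b2 a2 z b1 a1] T[of a3 a1 z b1 b3] T[of a3 b3 z b1 a1]
    T[of z b2 a2 a3 b3] T[of a3 b3 z b2 a2] T[of z b1 a2 b2 b3] T[of a3 a2 z b2 b3] T[of z b2 a1 a3 b3]
  show False
    using instances left sorted sides canons[simplified mem neq] by sat
qed

subsection \<open>Convex obstacles\<close>

text \<open>The frontier is a circle because bounded convex sets of equal dimension have
  homeomorphic relative frontiers; the closed disc serves for comparison.\<close>

lemma obstacle_interior_triangle:
  assumes "interior (convex hull {a, b, c}) \<noteq> {}"
  shows "obstacle (interior (convex hull {a, b, c}))"
proof -
  let ?T = "convex hull {a, b, c}"
  have "closure (interior ?T) = closure ?T"
    using assms by (simp add: convex_closure_interior)
  then have fr: "frontier (interior ?T) = frontier ?T"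
    by (simp add: frontier_def)
  have "polygonal_set (frontier ?T)"
    unfolding polygonal_set_def frontier_triangle
    by (intro exI[of _ "{(a, b), (b, c), (c, a)}"] exI[of _ "{}"]) auto
  moreover have "aff_dim ?T = aff_dim (cball (0::pt) 1)"
    using assms by (simp add: aff_dim_nonempty_interior aff_dim_cball)
  then have "rel_frontier ?T homeomorphic rel_frontier (cball (0::pt) 1)"
    by (intro homeomorphic_rel_frontiers_convex_bounded_sets) (auto intro: bounded_convex_hull)
  then have "frontier ?T homeomorphic (sphere (0::pt) 1)"
    using assms by (simp add: rel_frontier_nonempty_interior)
  ultimately show ?thesis
    using assms by (simp add: obstacle_def fr convex_connected)
qed

lemma obstacle_half_plane: "obstacle {x. x$1 > 0}"
proof -
  let ?L = "{x :: pt. x$1 = 0}"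
  have "{x :: pt. x$1 > 0} = {x. axis 1 1 \<bullet> x > 0}"
    by (simp add: inner_axis')
  then have fr: "frontier {x :: pt. x$1 > 0} = ?L"
    using frontier_halfspace_gt[of "axis 1 1 :: pt" 0] by (simp add: inner_axis' axis_eq_0_iff)
  have "\<exists>t\<ge>0. x = t *\<^sub>R axis 2 1 \<or> x = - (t *\<^sub>R axis 2 1)" if "x$1 = 0" for x :: pt
    by (rule exI[of _ "\<bar>x$2\<bar>"]) (use that in \<open>auto simp: pt_eq_iff axis_def abs_if\<close>)
  then have "?L = ray 0 (axis 2 1) \<union> ray 0 (- axis 2 1)"
    by (force simp: ray_def axis_def)
  then have "polygonal_set ?L"
    unfolding polygonal_set_def
    by (intro exI[of _ "{}"] exI[of _ "{(0, axis 2 1), (0, - axis 2 1)}"]) (simp add: axis_eq_0_iff)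
  moreover have "?L homeomorphic (UNIV :: real set)"
  proof -
    have "t \<in> (\<lambda>x. x$2) ` ?L" for t
      by (rule image_eqI[of _ _ "t *\<^sub>R axis 2 1"]) (simp_all add: axis_def)
    moreover have "x \<in> range (\<lambda>t. t *\<^sub>R axis 2 1)" if "x \<in> ?L" for x
      by (rule image_eqI[of _ _ "x$2"]) (use that in \<open>simp_all add: pt_eq_iff axis_def\<close>)
    ultimately have "homeomorphism ?L UNIV (\<lambda>x. x$2) (\<lambda>t. t *\<^sub>R axis 2 1)"
      unfolding homeomorphism_def by (auto simp: pt_eq_iff axis_def intro!: continuous_intros)
    then show ?thesis
      unfolding homeomorphic_def by blast
  qed
  moreover have "connected {x :: pt. x$1 > 0}" "open {x :: pt. x$1 > 0}"
    using convex_halfspace_gt[of 0 "axis 1 1 :: pt"] open_halfspace_gt[of 0 "axis 1 1 :: pt"]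
    by (simp_all add: inner_axis' convex_connected)
  moreover have "axis 1 1 \<in> {x :: pt. x$1 > 0}"
    by (simp add: axis_def)
  ultimately show ?thesis
    unfolding obstacle_def fr by blast
qed

lemma drawing_disjoint: "P \<inter> C = {} \<Longrightarrow> drawing C P \<inter> C = {}"
  by (auto simp: drawing_def visible_def)

section \<open>The single vertex\<close>

lemma single_vertex_outside: "has_outside_obstacle_rep {0 :: nat} (\<lambda>u v. False)"
proof -
  let ?C = "{x :: pt. x$1 > 0}"
  have "single_obstacle_rep {0 :: nat} (\<lambda>u v. False) {0} ?C"
    unfolding single_obstacle_rep_def
    by (auto simp: obstacle_half_plane general_position_def visible_def bij_betw_def)
  moreover have "drawing ?C {0} = {0}"
    by (auto simp: drawing_def visible_def)
  \<comment> \<open>The complement of a point in the plane is connected and unbounded, hence all of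
    it is \<open>outside\<close>.\<close>
  then have "?C \<subseteq> outside (drawing ?C {0})"
    by auto
  ultimately show ?thesis
    unfolding has_outside_obstacle_rep_def by blast
qed

lemma single_vertex_not_inside: "\<not> has_inside_obstacle_rep {0 :: nat} E"
proof
  assume "has_inside_obstacle_rep {0 :: nat} E"
  then obtain P C f where C: "obstacle C" "P \<inter> C = {}" and f: "bij_betw f {0 :: nat} P"
    and out: "C \<inter> outside (drawing C P) = {}"
    unfolding has_inside_obstacle_rep_def single_obstacle_rep_def by blast
  have "P = {f 0}"
    using f by (auto simp: bij_betw_def)
  then have "drawing C P = {f 0}"
    by (auto simp: drawing_def visible_def)
  then show False
    using C out \<open>P = {f 0}\<close> by (auto simp: obstacle_def)
qed

section \<open>A criterion for inside representations, and integer certificates\<close>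

lemma subset_inside_if_triangle:
  assumes "obstacle C" "P \<inter> C = {}" "visible C P a b" "visible C P b c" "visible C P c a"
    and x: "x \<in> C" "x \<in> convex hull {a, b, c}"
  shows "C \<inter> outside (drawing C P) = {}"
proof (rule ccontr)
  assume "C \<inter> outside (drawing C P) \<noteq> {}"
  then obtain y where y: "y \<in> C" "y \<in> outside (drawing C P)" by blast
  \<comment> \<open>A connected obstacle avoiding the drawing lies in one complementary component,
    so the single point \<open>x\<close> decides for all of \<open>C\<close>.\<close>
  have "C \<subseteq> - drawing C P" "connected C"
    using assms drawing_disjoint[of P C] by (auto simp: obstacle_def)
  then have "connected_component (- drawing C P) y x"
    using x y unfolding connected_component_def by blast
  then have "x \<in> outside (drawing C P)"
    using y outside_same_component by blast
  moreover have "convex hull {a, b, c} \<inter> outside (drawing C P) = {}"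
    using assms(3-5)[THEN closed_segment_subset_drawing]
    by (intro disjoint_outside_if_frontier_subset) (auto simp: frontier_triangle intro: bounded_convex_hull)
  ultimately show False using x by blast
qed

text \<open>All coordinates of the construction are half-integers; doubling them makes the checks
  executable on integers.\<close>
definition half_pt :: "int \<times> int \<Rightarrow> pt" where
  "half_pt p = vector [real_of_int (fst p) / 2, real_of_int (snd p) / 2]"

definition int_orient :: "int \<times> int \<Rightarrow> int \<times> int \<Rightarrow> int \<times> int \<Rightarrow> int" where
  "int_orient p q r = (fst q - fst p) * (snd r - snd p) - (snd q - snd p) * (fst r - fst p)"

lemma half_pt_nth [simp]: "half_pt p $ 1 = real_of_int (fst p) / 2" "half_pt p $ 2 = real_of_int (snd p) / 2"
  by (simp_all add: half_pt_def vector_2)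

lemma half_pt_eq_iff [simp]: "half_pt p = half_pt q \<longleftrightarrow> p = q"
  by (simp add: pt_eq_iff prod_eq_iff)

lemma orient_half_pt: "orient (half_pt p) (half_pt q) (half_pt r) = real_of_int (int_orient p q r) / 4"
  by (simp add: orient_def int_orient_def algebra_simps)

lemma half_pt_vertices:
  "half_pt (0, 0) = 0" "half_pt (2, 0) = vector [1, 0]" "half_pt (0, 2) = vector [0, 1]"
  by (simp_all add: pt_eq_iff vector_2)

text \<open>\<open>orient p q\<close> is affine, and the weights are the barycentric coordinates of
  \<open>x\<close> in the standard triangle.\<close>

lemma orient_barycentric:
  "orient p q x = (1 - x$1 - x$2) * orient p q (half_pt (0, 0)) + x$1 * orient p q (half_pt (2, 0))
     + x$2 * orient p q (half_pt (0, 2))"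
  unfolding orient_def half_pt_vertices by (simp only: vector_2 zero_index) algebra

lemma eq_if_orient_eq_0:
  assumes "orient p q (half_pt (0, 0)) = 0" "orient p q (half_pt (2, 0)) = 0" "orient p q (half_pt (0, 2)) = 0"
  shows "p = q"
proof -
  have "orient p q (half_pt (2, 0)) - orient p q (half_pt (0, 0)) = p$2 - q$2"
    "orient p q (half_pt (0, 2)) - orient p q (half_pt (0, 0)) = q$1 - p$1"
    unfolding orient_def half_pt_vertices by (simp_all only: vector_2 zero_index) algebra+
  then show ?thesis
    using assms by (simp add: pt_eq_iff)
qed

definition triangle :: "pt set" where
  "triangle = {x. 0 < x$1 \<and> 0 < x$2 \<and> x$1 + x$2 < 1}"

lemma obstacle_triangle: "obstacle triangle"
proof -
  have B: "insert 0 Basis = {0 :: pt, axis 1 1, axis 2 1}"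
    by (auto simp: Basis_vec_def UNIV_2)
  have "axis 1 1 \<noteq> (axis 2 1 :: pt)"
    by (simp add: axis_eq_axis)
  then have "triangle = interior (convex hull {0, axis 1 1, axis 2 1})"
    unfolding B[symmetric] interior_std_simplex
    by (auto simp: triangle_def Basis_vec_def UNIV_2 inner_axis)
  moreover have "vector [1/3, 1/3] \<in> triangle"
    by (simp add: triangle_def vector_2)
  ultimately show ?thesis
    using obstacle_interior_triangle by (metis empty_iff)
qed

text \<open>An integer certificate that a segment misses the open triangle: either the hypotenuse or
  the line \<open>pq\<close> itself separates them. The bound 2 and the vertices are in doubled
  coordinates.\<close>

definition separated :: "int \<times> int \<Rightarrow> int \<times> int \<Rightarrow> bool" where
  "separated p q \<longleftrightarrow> fst p + snd p \<ge> 2 \<and> fst q + snd q \<ge> 2 \<or>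
    (\<forall>v \<in> {(0, 0), (2, 0), (0, 2)}. int_orient p q v \<ge> 0) \<or>
    (\<forall>v \<in> {(0, 0), (2, 0), (0, 2)}. int_orient p q v \<le> 0)"

lemma same_sign_combination_eq_0:
  fixes u v w x y z :: real
  assumes "u * x + v * y + w * z = 0" and pos: "0 < u" "0 < v" "0 < w"
    and "0 \<le> x \<and> 0 \<le> y \<and> 0 \<le> z \<or> x \<le> 0 \<and> y \<le> 0 \<and> z \<le> 0"
  shows "x = 0" "y = 0" "z = 0"
proof -
  have "u * x = 0 \<and> v * y = 0 \<and> w * z = 0"
    using assms(5)
  proof
    assume "0 \<le> x \<and> 0 \<le> y \<and> 0 \<le> z"
    then have "0 \<le> u * x" "0 \<le> v * y" "0 \<le> w * z"
      using pos by simp_all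
    then show ?thesis using assms(1) by linarith
  next
    assume "x \<le> 0 \<and> y \<le> 0 \<and> z \<le> 0"
    then have "u * x \<le> 0" "v * y \<le> 0" "w * z \<le> 0"
      using pos by (simp_all add: mult_le_0_iff)
    then show ?thesis using assms(1) by linarith
  qed
  then show "x = 0" "y = 0" "z = 0"
    using pos by simp_all
qed

text \<open>If the line \<open>pq\<close> separates, a common point has orientation zero, which is a
  positive combination of vertex values without mixed signs; all of them vanish, forcing
  \<open>p = q\<close>.\<close>

lemma separated_disjoint:
  assumes "separated p q" "p \<noteq> q"
  shows "closed_segment (half_pt p) (half_pt q) \<inter> triangle = {}"
proof -
  let ?p = "half_pt p" and ?q = "half_pt q"
  have False if x: "x \<in> closed_segment ?p ?q" "x \<in> triangle" for x
  proof -
    obtain t where t: "0 \<le> t" "t \<le> 1" and xt: "x = (1 - t) *\<^sub>R ?p + t *\<^sub>R ?q"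
      using x by (auto simp: in_segment)
    have pos: "0 < 1 - x$1 - x$2" "0 < x$1" "0 < x$2"
      using x by (auto simp: triangle_def)
    show False
    proof (cases "fst p + snd p \<ge> 2 \<and> fst q + snd q \<ge> 2")
      case True
      then have "real_of_int (fst p + snd p) \<ge> 2" "real_of_int (fst q + snd q) \<ge> 2"
        by linarith+
      then have *: "?p$1 + ?p$2 \<ge> 1" "?q$1 + ?q$2 \<ge> 1"
        by simp_all
      have "(1 - t) * 1 + t * 1 \<le> (1 - t) * (?p$1 + ?p$2) + t * (?q$1 + ?q$2)"
        using * t by (intro add_mono mult_left_mono) auto
      also have "\<dots> = x$1 + x$2"
        by (simp add: xt algebra_simps del: half_pt_nth)
      finally show False using pos by simp
    next
      case False
      let ?o = "\<lambda>v. orient ?p ?q (half_pt v)"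
      have signs: "0 \<le> ?o (0, 0) \<and> 0 \<le> ?o (2, 0) \<and> 0 \<le> ?o (0, 2) \<or>
          ?o (0, 0) \<le> 0 \<and> ?o (2, 0) \<le> 0 \<and> ?o (0, 2) \<le> 0"
        using assms(1) False by (auto simp: separated_def orient_half_pt)
      have "orient ?p ?q x = 0"
        unfolding xt orient_affine by (simp add: orient_def)
      then have "(1 - x$1 - x$2) * ?o (0, 0) + x$1 * ?o (2, 0) + x$2 * ?o (0, 2) = 0"
        using orient_barycentric[of ?p ?q x] by linarith
      note same_sign_combination_eq_0[OF this pos signs]
      then have "?p = ?q"
        by (rule eq_if_orient_eq_0)
      then show False using assms(2) by simp
    qed
  qed
  then show ?thesis by blast
qed

subsection \<open>The complement of a spider\<close>

text \<open>The non-edges form a spider with centre \<open>10\<close> (the point \<open>z\<close>), inner vertices \<open>b\<^sub>i = i + 5\<close> and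
  leaves \<open>a\<^sub>i = i\<close> for \<open>i < 5\<close>.\<close>
definition spider_edge :: "nat \<Rightarrow> nat \<Rightarrow> bool" where
  "spider_edge u v \<longleftrightarrow> u < 5 \<and> v = u + 5 \<or> 5 \<le> u \<and> u < 10 \<and> v = 10"

definition co_spider :: "nat \<Rightarrow> nat \<Rightarrow> bool" where
  "co_spider u v \<longleftrightarrow> u \<noteq> v \<and> \<not> spider_edge u v \<and> \<not> spider_edge v u"

text \<open>Undoubled, \<open>b\<^sub>i = (1, 1) - 2a\<^sub>i\<close>, so that all segments \<open>a\<^sub>ib\<^sub>i\<close> pass through the centroid of the
  triangle, and \<open>z\<close> is the midpoint of its hypotenuse, which separates the \<open>a\<^sub>i\<close> from the \<open>b\<^sub>i\<close>.\<close>
definition coords :: "(int \<times> int) list" where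
  "coords = [(6, 0), (8, 2), (8, 6), (2, 8), (-2, 8),
     (-10, 2), (-14, -2), (-14, -10), (-2, -14), (6, -14), (1, 1)]"

lemma crosses_centroid:
  assumes "fst q = 2 - 2 * fst p" "snd q = 2 - 2 * snd p"
  shows "closed_segment (half_pt p) (half_pt q) \<inter> triangle \<noteq> {}"
proof -
  \<comment> \<open>Undoubled, \<open>q\<close> is (1, 1) - 2p, so the weights 2/3 and 1/3 cancel
    \<open>p\<close>.\<close>
  have "vector [1/3, 1/3] = (1 - 1/3) *\<^sub>R half_pt p + (1/3) *\<^sub>R half_pt q"
    by (simp add: pt_eq_iff vector_2 assms diff_divide_distrib)
  then have "vector [1/3, 1/3] \<in> closed_segment (half_pt p) (half_pt q)"
    unfolding in_segment by (intro exI[of _ "1/3"]) simp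
  moreover have "vector [1/3, 1/3] \<in> triangle"
    by (simp add: triangle_def vector_2)
  ultimately show ?thesis by blast
qed

lemma enters_at_hypotenuse:
  assumes "-14 \<le> fst p" "-14 \<le> snd p" "fst p + snd p < 2"
  shows "closed_segment (half_pt p) (half_pt (1, 1)) \<inter> triangle \<noteq> {}"
proof -
  \<comment> \<open>A point near the midpoint of the hypotenuse: the weight 15/16 gives the
    coordinates (fst p + 15) / 32 and (snd p + 15) / 32, which are positive.\<close>
  let ?x = "(1 - 15/16) *\<^sub>R half_pt p + (15/16) *\<^sub>R half_pt (1, 1)"
  have "?x \<in> closed_segment (half_pt p) (half_pt (1, 1))"
    unfolding in_segment by (intro exI[of _ "15/16"]) simp
  moreover have "real_of_int (fst p) + real_of_int (snd p) < 2"
    using assms(3) by linarith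
  then have "?x \<in> triangle"
    using assms(1,2) by (simp add: triangle_def)
  ultimately show ?thesis by blast
qed

lemma co_spider_separated:
  assumes "u < 11" "v < 11" "co_spider u v"
  shows "separated (coords ! u) (coords ! v)"
proof -
  have "\<forall>u\<in>set [0..<11]. \<forall>v\<in>set [0..<11]. co_spider u v \<longrightarrow> separated (coords ! u) (coords ! v)"
    by code_simp
  then show ?thesis using assms by simp
qed

lemma spider_edge_crosses:
  assumes "spider_edge u v"
  shows "closed_segment (half_pt (coords ! u)) (half_pt (coords ! v)) \<inter> triangle \<noteq> {}"
proof -
  have 1: "\<forall>u\<in>set [0..<5]. fst (coords ! (u + 5)) = 2 - 2 * fst (coords ! u) \<and>
      snd (coords ! (u + 5)) = 2 - 2 * snd (coords ! u)"
    by code_simp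
  have "\<forall>u\<in>set [5..<10]. -14 \<le> fst (coords ! u) \<and> -14 \<le> snd (coords ! u) \<and>
      fst (coords ! u) + snd (coords ! u) < 2"
    by code_simp
  then have 2: "-14 \<le> fst (coords ! u) \<and> -14 \<le> snd (coords ! u) \<and>
      fst (coords ! u) + snd (coords ! u) < 2" if "5 \<le> u" "u < 10"
    unfolding set_upt using that by (meson atLeastLessThan_iff)
  have 3: "coords ! 10 = (1, 1)"
    by code_simp
  show ?thesis
    using assms unfolding spider_edge_def
  proof (elim disjE conjE)
    assume "u < 5" "v = u + 5"
    then show ?thesis using 1 by (intro crosses_centroid) auto
  next
    assume "5 \<le> u" "u < 10" "v = 10"
    then show ?thesis using 2 3 enters_at_hypotenuse[of "coords ! u"] by simp
  qed
qed

lemma distinct_coords: "distinct coords" and length_coords: "length coords = 11"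
  by code_simp+

lemma general_position_coords: "general_position (half_pt ` set coords)"
proof -
  have "\<forall>p\<in>set coords. \<forall>q\<in>set coords. \<forall>r\<in>set coords. p = q \<or> q = r \<or> p = r \<or> int_orient p q r \<noteq> 0"
    by code_simp
  then show ?thesis
    unfolding general_position_def by (simp add: collinear_iff_orient orient_half_pt) blast
qed

lemma coords_not_in_triangle: "half_pt ` set coords \<inter> triangle = {}"
  by (auto simp: coords_def triangle_def)

lemma co_spider_inside: "has_inside_obstacle_rep {..<11} co_spider"
proof -
  let ?f = "\<lambda>u. half_pt (coords ! u)" and ?P = "half_pt ` set coords"
  have set: "set coords = (!) coords ` {..<11}"
    by (auto simp: set_conv_nth length_coords)
  have inj: "inj_on ?f {..<11}"
    by (auto simp: inj_on_def nth_eq_iff_index_eq[OF distinct_coords] length_coords)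
  have bij: "bij_betw ?f {..<11} ?P"
    unfolding set image_image using inj by (simp add: bij_betw_def)
  have vis: "co_spider u v \<longleftrightarrow> visible triangle ?P (?f u) (?f v)" if "u < 11" "v < 11" for u v
  proof (cases "u = v")
    case True
    then show ?thesis by (simp add: co_spider_def visible_def)
  next
    case False
    have ne: "?f u \<noteq> ?f v"
      using inj_onD[OF inj, of u v] False that by auto
    have "co_spider u v \<longleftrightarrow> closed_segment (?f u) (?f v) \<inter> triangle = {}"
    proof
      assume "co_spider u v"
      then show "closed_segment (?f u) (?f v) \<inter> triangle = {}"
        using ne that by (intro separated_disjoint co_spider_separated) auto
    next
      assume "closed_segment (?f u) (?f v) \<inter> triangle = {}"
      then show "co_spider u v"
        using spider_edge_crosses[of u v] spider_edge_crosses[of v u] False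
        by (auto simp: co_spider_def closed_segment_commute)
    qed
    then show ?thesis
      using that ne by (auto simp: visible_def set)
  qed
  have rep: "single_obstacle_rep {..<11} co_spider ?P triangle"
    unfolding single_obstacle_rep_def
    using obstacle_triangle general_position_coords coords_not_in_triangle bij vis by blast
  \<comment> \<open>The points \<open>a\<^sub>0\<close>, \<open>a\<^sub>4\<close>,
    \<open>b\<^sub>2\<close> span a drawn triangle around the centroid.\<close>
  have "co_spider 0 4" "co_spider 4 7" "co_spider 7 0"
    by code_simp+
  then have "visible triangle ?P (?f 0) (?f 4)" "visible triangle ?P (?f 4) (?f 7)"
    "visible triangle ?P (?f 7) (?f 0)"
    by (simp_all add: vis)
  moreover have "vector [1/3, 1/3] \<in> triangle"
    by (simp add: triangle_def vector_2)
  moreover have "vector [1/3, 1/3] \<in> convex hull {?f 0, ?f 4, ?f 7}"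
    by (rule mem_triangle) (simp_all add: orient_def coords_def vector_2)
  ultimately have "triangle \<inter> outside (drawing triangle ?P) = {}"
    by (rule subset_inside_if_triangle[OF obstacle_triangle coords_not_in_triangle])
  then show ?thesis
    unfolding has_inside_obstacle_rep_def using rep by blast
qed

section \<open>Nonexistence of an outside representation\<close>

lemma turn_common_neighbours:
  assumes "C \<subseteq> outside (drawing C P)" "general_position P" "b \<in> P" "d \<in> P" "b \<noteq> d" "\<not> visible C P b d"
    "visible C P a b" "visible C P a d" "visible C P c b" "visible C P c d" and s: "s \<noteq> 0"
  shows "turn s b d a \<longleftrightarrow> turn s b d c"
proof -
  have "0 < orient b d a \<longleftrightarrow> 0 < orient b d c"
    by (rule common_neighbours_same_side[OF assms(1-10)])
  \<comment> \<open>As no orientation is zero, agreement on positive signs gives agreement on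
    negative ones, which covers negative \<open>s\<close>.\<close>
  moreover have "orient b d x \<noteq> 0" if "visible C P x b" "visible C P x d" for x
    using that assms(2-6) unfolding general_position_def visible_def
    by (metis collinear_iff_orient)
  then have "orient b d a \<noteq> 0" "orient b d c \<noteq> 0"
    using assms by blast+
  ultimately show ?thesis
    using s unfolding turn_def zero_less_mult_iff by linarith
qed

lemma co_spider_not_outside: "\<not> has_outside_obstacle_rep {..<11} co_spider"
proof
  assume "has_outside_obstacle_rep {..<11} co_spider"
  then obtain P C f where C: "C \<subseteq> outside (drawing C P)" and P: "general_position P"
    and f: "bij_betw f {..<11 :: nat} P"
    and vis: "\<And>u v. u < 11 \<Longrightarrow> v < 11 \<Longrightarrow> co_spider u v \<longleftrightarrow> visible C P (f u) (f v)"
    unfolding has_outside_obstacle_rep_def single_obstacle_rep_def by (metis lessThan_iff)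
  have fP: "f u \<in> P" if "u < 11" for u
    using bij_betwE[OF f] that by simp
  have f_eq: "f u = f v \<longleftrightarrow> u = v" if "u < 11" "v < 11" for u v
    using bij_betw_imp_inj_on[OF f] that by (simp add: inj_on_eq_iff)
  define a b z where "a = f" and "b = (\<lambda>i. f (i + 5))" and "z = f 10"
  have common: "turn s (f u) (f v) (f w) \<longleftrightarrow> turn s (f u) (f v) (f x)"
    if "u < 11" "v < 11" "w < 11" "x < 11" "spider_edge u v \<or> spider_edge v u"
      "co_spider w u" "co_spider w v" "co_spider x u" "co_spider x v" "s \<noteq> 0" for s u v w x
  proof (rule turn_common_neighbours[OF C P])
    show "f u \<noteq> f v"
      using that by (auto simp: f_eq spider_edge_def)
    have "\<not> co_spider u v"
      using that by (auto simp: co_spider_def)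
    then show "\<not> visible C P (f u) (f v)"
      using that by (simp add: vis)
  qed (use that in \<open>simp_all add: fP flip: vis\<close>)
  \<comment> \<open>The common neighbours of \<open>a i\<close> and \<open>b i\<close> are the
    points of all other pairs, without \<open>z\<close>.\<close>
  have pair: "turn s (a i) (b i) x \<longleftrightarrow> turn s (a i) (b i) y"
    if "s \<noteq> 0" "i < 5" "j < 5" "k < 5" "i \<noteq> j" "i \<noteq> k" "x \<in> {a j, b j, a k, b k}" "y \<in> {a j, b j, a k, b k}"
    for s i j k x y
  proof -
    note prems = that
    obtain u v where uv: "x = f u" "y = f v" "u \<in> {j, j + 5, k, k + 5}" "v \<in> {j, j + 5, k, k + 5}"
      using prems(7,8) unfolding a_def b_def by blast
    show ?thesis
      using prems(1-6) uv(3,4) unfolding a_def b_def uv(1,2)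
      by (intro common) (auto simp: co_spider_def spider_edge_def)
  qed
  \<comment> \<open>The common neighbours of \<open>z\<close> and \<open>b i\<close> are the
    \<open>a j\<close> with \<open>j\<close> different from \<open>i\<close>.\<close>
  have spoke: "turn s z (b i) (a j) \<longleftrightarrow> turn s z (b i) (a k)"
    if "s \<noteq> 0" "i < 5" "j < 5" "k < 5" "i \<noteq> j" "i \<noteq> k" for s i j k
    using that unfolding a_def b_def z_def
    by (intro common) (auto simp: co_spider_def spider_edge_def)
  have mem: "z \<in> P" "i < 5 \<Longrightarrow> a i \<in> P" "i < 5 \<Longrightarrow> b i \<in> P" for i
    by (auto simp: a_def b_def z_def intro: fP)
  have ne: "z \<noteq> a i" "z \<noteq> b i" "a i \<noteq> b j" "b j \<noteq> a i" "a i = a j \<longleftrightarrow> i = j" "b i = b j \<longleftrightarrow> i = j"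
    if "i < 5" "j < 5" for i j
    using that by (auto simp: a_def b_def z_def f_eq)
  have sorted: False
    if s: "s \<noteq> 0" and ijk: "i < 5" "j < 5" "k < 5" "distinct [i, j, k]"
      and ord: "turn s z (b i) (b j)" "turn s z (b j) (b k)" "turn s z (b i) (b k)"
      and left: "\<And>m n. m \<in> {i, j, k} \<Longrightarrow> n \<in> {i, j, k} \<Longrightarrow> m \<noteq> n \<Longrightarrow> turn s z (b m) (a n)"
    for s i j k
  proof (rule no_sorted_triple[OF P])
    show "{z, a i, a j, a k, b i, b j, b k} \<subseteq> P"
      using ijk mem by simp
    show "distinct [z, a i, a j, a k, b i, b j, b k]"
      using ijk by (simp add: ne)
    show "turn s (a i) (b i) x \<longleftrightarrow> turn s (a i) (b i) y"
      if "x \<in> {a j, b j, a k, b k}" "y \<in> {a j, b j, a k, b k}" for x y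
      using ijk that by (intro pair[OF s, of i j k]) auto
    show "turn s (a j) (b j) x \<longleftrightarrow> turn s (a j) (b j) y"
      if "x \<in> {a i, b i, a k, b k}" "y \<in> {a i, b i, a k, b k}" for x y
      using ijk that by (intro pair[OF s, of j i k]) auto
    show "turn s (a k) (b k) x \<longleftrightarrow> turn s (a k) (b k) y"
      if "x \<in> {a i, b i, a j, b j}" "y \<in> {a i, b i, a j, b j}" for x y
      using ijk that by (intro pair[OF s, of k i j]) auto
  qed (use ijk s ord in \<open>simp_all add: left\<close>)
  \<comment> \<open>The fourth \<open>a\<^sub>l\<close> forces \<open>b\<^sub>i, b\<^sub>j, b\<^sub>k\<close> into a half-plane at \<open>z\<close>, where they can be sorted by angle.\<close>
  have no_three: False
    if s: "s \<noteq> 0" and T: "{i, j, k, l} \<subseteq> {..<5}" "distinct [i, j, k, l]"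
      and left: "\<And>m n. m \<in> {i, j, k} \<Longrightarrow> n < 5 \<Longrightarrow> m \<noteq> n \<Longrightarrow> turn s z (b m) (a n)"
    for s i j k l
  proof -
    let ?L = "\<lambda>m n. turn s z (b m) (b n)"
    have total: "?L m n \<or> ?L n m" if "m \<in> {i, j, k}" "n \<in> {i, j, k}" "m \<noteq> n" for m n
    proof -
      have "m < 5" "n < 5" using that T by auto
      then show ?thesis
        using turn_swap[OF P _ _ _ _ _ _ s, of z "b m" "b n"] turn_rotate[of s] mem ne that(3) by metis
    qed
    have trans: "?L m q" if "?L m n" "?L n q" "{m, n, q} \<subseteq> {i, j, k}" for m n q
      using that left[of m l] left[of n l] left[of q l] T
      by (intro turn_trans'[of s z "b m" "a l" "b n" "b q"]) auto
    have srt: False if "{m, n, q} \<subseteq> {i, j, k}" "distinct [m, n, q]" "?L m n" "?L n q" for m n q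
      using that T trans[OF that(3,4,1)] by (intro sorted[OF s, of m n q]) (auto intro: left)
    \<comment> \<open>Every tournament on three vertices has a directed path through all of them, so
      one of the six orders applies.\<close>
    show False
      using total[of i j] total[of j k] total[of i k] srt[of i j k] srt[of i k j] srt[of j i k]
        srt[of j k i] srt[of k i j] srt[of k j i] T(2) by auto
  qed
  \<comment> \<open>The conditional merely picks some index other than \<open>i\<close>; by
    \<open>spoke\<close> the choice is irrelevant.\<close>
  define A where "A = {i. i < 5 \<and> turn 1 z (b i) (a (if i = 0 then 1 else 0))}"
  have A: "turn 1 z (b i) (a j) \<longleftrightarrow> i \<in> A" if "i < 5" "j < 5" "i \<noteq> j" for i j
    using spoke[of 1 i j "if i = 0 then 1 else 0"] that by (simp add: A_def)
  have turn_minus: "turn (-1) z (b i) (a j) \<longleftrightarrow> \<not> turn 1 z (b i) (a j)" if "i < 5" "j < 5" "i \<noteq> j" for i j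
  proof -
    have "turn (-1) z (b i) (a j) \<longleftrightarrow> turn 1 (b i) z (a j)"
      by (simp add: turn_def orient_swap[of "b i"])
    then show ?thesis
      using turn_swap[OF P, of z "b i" "a j" 1] ne(4)[of j i] that by (simp add: mem ne)
  qed
  have three: False if s: "s \<noteq> 0" and B: "B \<subseteq> {..<5}" "card B \<ge> 3"
    and left: "\<And>m n. m \<in> B \<Longrightarrow> n < 5 \<Longrightarrow> m \<noteq> n \<Longrightarrow> turn s z (b m) (a n)" for s B
  proof -
    obtain T where T: "T \<subseteq> B" "card T = 3"
      using B(2) by (meson obtain_subset_with_card_n)
    then obtain i j k where ijk: "T = {i, j, k}" "distinct [i, j, k]"
      by (auto simp: card_3_iff)
    \<comment> \<open>This yields an index \<open>l\<close> outside \<open>T\<close>, so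
      \<open>a l\<close> lies on the required side of all three lines.\<close>
    have "\<not> {..<5} \<subseteq> T"
      using card_mono[of T "{..<5}"] T(2) ijk by auto
    then obtain l where "l < 5" "l \<notin> T" by auto
    then show False
      using T B ijk by (intro no_three[OF s, of i j k l] left) auto
  qed
  have sub: "A \<subseteq> {..<5}"
    by (auto simp: A_def)
  have "card A + card ({..<5} - A) = 5"
    using card_mono[OF _ sub] finite_subset[OF sub] sub by (simp add: card_Diff_subset)
  then consider "card A \<ge> 3" | "card ({..<5} - A) \<ge> 3" by linarith
  then show False
  proof cases
    case 1
    show False
      by (rule three[OF _ _ 1, of 1]) (use sub in \<open>auto simp: A subset_eq\<close>)
  next
    case 2
    show False
      by (rule three[OF _ _ 2, of "-1"]) (auto simp: turn_minus A)
  qed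
qed

theorem theorem4:
  shows "(\<exists>(V :: nat set) E. has_inside_obstacle_rep V E \<and> \<not> has_outside_obstacle_rep V E) \<and>
         (\<exists>(V :: nat set) E. has_outside_obstacle_rep V E \<and> \<not> has_inside_obstacle_rep V E)"
  using co_spider_inside co_spider_not_outside single_vertex_outside single_vertex_not_inside by blast

end
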